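(* Let $A=\{a_1,a_2,\ldots,a_d\}$ with $a_1<a_2<\cdots<a_d$ positive integers, or $A=\{a_1,a_2,\ldots\}$ with $a_1<a_2<\cdots$ positive integers (in which case $d=\infty$). Then, as formal power series, $$C_{112}(x,y,z)= \frac{1}{1-\sum_{j=1}^d\left( x^{a_j}z\prod_{i=1}^{j-1}(1-(1-y)x^{2a_i}z^2)\right)}$$ and $$C_{221}(x,y,z)=\frac{1}{1-\sum_{j=1}^d\left(x^{a_j}z\prod_{i=j+1}^d(1-(1-y)x^{2a_i}z^2)\right)}.$$
   Context: A composition of $n$ with parts in $A$ is a finite sequence $\sigma=\sigma_1\cdots\sigma_m$ ($m\ge0$) of elements of $A$ summing to $n$; $m$ is its number of parts (the empty composition of $0$ is included). An occurrence of the pattern $112$ in $\sigma$ is an index $i$, $1\le i\le m-2$, with $\sigma_i=\sigma_{i+1}<\sigma_{i+2}$; an occurrence of $221$ is an index $i$ with $\sigma_i=\sigma_{i+1}>\sigma_{i+2}$. For $\tau\in\{112,221\}$, $C_{\tau}(x,y,z)=\sum_\sigma x^{n(\sigma)}y^{r_\tau(\sigma)}z^{m(\sigma)}$, summing over all compositions $\sigma$ with parts in $A$, where $n(\sigma)$ is the sum of parts, $m(\sigma)$ the number of parts and $r_\tau(\sigma)$ the number of occurrences of $\tau$ in $\sigma$. *)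

theory Defs
  imports
    "HOL-Computational_Algebra.Formal_Power_Series"
    "HOL-Analysis.Infinite_Sum"
    "HOL-Analysis.Infinite_Products"
    "HOL-Library.Extended_Nat"
begin

unbundle no vec_syntax
unbundle fps_syntax

text \<open>
  Formal power series in \<open>x, y, z\<close> over the rationals are rendered as iterated univariate series:
  the outermost variable is \<open>x\<close>, then \<open>y\<close>, then \<open>z\<close>. Limits, and hence infinite sums and
  products, refer to the library's metric on the outermost level, that is, to the \<open>x\<close>-adic
  topology: every coefficient of a power of \<open>x\<close> is eventually constant.
\<close>

type_synonym fps3 = "rat fps fps fps"

definition X :: fps3 where "X = fps_X"
definition Y :: fps3 where "Y = fps_const fps_X"
definition Z :: fps3 where "Z = fps_const (fps_const fps_X)"

definition compositions :: "nat set \<Rightarrow> nat list set" where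
  "compositions A = {\<sigma>. set \<sigma> \<subseteq> A}"

text \<open>Positions in a list are counted from 0.\<close>

definition occ112 :: "nat list \<Rightarrow> nat" where
  "occ112 \<sigma> = card {i. i + 2 < length \<sigma> \<and> \<sigma> ! i = \<sigma> ! (i + 1) \<and> \<sigma> ! (i + 1) < \<sigma> ! (i + 2)}"

definition occ221 :: "nat list \<Rightarrow> nat" where
  "occ221 \<sigma> = card {i. i + 2 < length \<sigma> \<and> \<sigma> ! i = \<sigma> ! (i + 1) \<and> \<sigma> ! (i + 1) > \<sigma> ! (i + 2)}"

definition C112 :: "nat set \<Rightarrow> fps3" where
  "C112 A = (\<Sum>\<^sub>\<infinity>\<sigma>\<in>compositions A. X ^ sum_list \<sigma> * Y ^ occ112 \<sigma> * Z ^ length \<sigma>)"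

definition C221 :: "nat set \<Rightarrow> fps3" where
  "C221 A = (\<Sum>\<^sub>\<infinity>\<sigma>\<in>compositions A. X ^ sum_list \<sigma> * Y ^ occ221 \<sigma> * Z ^ length \<sigma>)"

text \<open>The index range \<open>1, \<dots>, d\<close> where possibly \<open>d = \<infinity>\<close>.\<close>

definition idx :: "enat \<Rightarrow> nat set" where
  "idx d = {j. 1 \<le> j \<and> enat j \<le> d}"

text \<open>
  The library's infinite sums, infinite products and quotients are total. The following facts
  show that none of those used here takes a default value.
\<close>

lemma X_power_mult_nth: "(X ^ k * f) $ n = (if n < k then 0 else f $ (n - k))"
  by (simp add: X_def fps_X_power_mult_nth)

lemma summable_onI_fps:
  fixes f :: "'b \<Rightarrow> 'a::ab_group_add fps"
  assumes fin: "\<And>n. finite {s \<in> S. f s $ n \<noteq> 0}"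
  shows "f summable_on S"
proof -
  define g where "g = Abs_fps (\<lambda>n. \<Sum>s\<in>{s \<in> S. f s $ n \<noteq> 0}. f s $ n)"
  have "(sum f \<longlongrightarrow> g) (finite_subsets_at_top S)"
  proof (rule tendsto_fpsI)
    fix n
    let ?T = "{s \<in> S. f s $ n \<noteq> 0}"
    have "\<forall>\<^sub>F F in finite_subsets_at_top S. finite F \<and> ?T \<subseteq> F \<and> F \<subseteq> S"
      unfolding eventually_finite_subsets_at_top using fin[of n] by (intro exI[of _ ?T]) auto
    then show "\<forall>\<^sub>F F in finite_subsets_at_top S. sum f F $ n = g $ n"
    proof eventually_elim
      case (elim F)
      then have "(\<Sum>s\<in>F. f s $ n) = (\<Sum>s\<in>?T. f s $ n)"
        by (intro sum.mono_neutral_right) auto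
      then show ?case by (simp add: fps_sum_nth g_def)
    qed
  qed
  then show ?thesis by (auto simp: summable_on_def has_sum_def)
qed

lemma finite_compositions:
  assumes "0 \<notin> A"
  shows "finite {\<sigma> \<in> compositions A. sum_list \<sigma> \<le> n}"
proof (rule finite_subset)
  show "{\<sigma> \<in> compositions A. sum_list \<sigma> \<le> n} \<subseteq> {\<sigma>. set \<sigma> \<subseteq> {..n} \<and> length \<sigma> \<le> n}"
  proof safe
    fix \<sigma> assume *: "\<sigma> \<in> compositions A" "sum_list \<sigma> \<le> n"
    { fix k assume "k \<in> set \<sigma>"
      then show "k \<le> n" using member_le_sum_list[of k \<sigma>] *(2) by simp }
    have "length \<sigma> \<le> sum_list \<sigma>"
      using *(1)
    proof (induction \<sigma>)
      case (Cons k \<sigma>)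
      then have "k \<in> A" "length \<sigma> \<le> sum_list \<sigma>" by (auto simp: compositions_def)
      moreover have "k \<noteq> 0" using \<open>k \<in> A\<close> assms by metis
      ultimately show ?case by simp
    qed simp
    then show "length \<sigma> \<le> n" using *(2) by simp
  qed
  show "finite {\<sigma>. set \<sigma> \<subseteq> {..n} \<and> length \<sigma> \<le> n}"
    by (rule finite_lists_length_le) simp
qed

lemma summable_compositions:
  assumes "0 \<notin> A"
  shows "(\<lambda>\<sigma>. X ^ sum_list \<sigma> * Y ^ r \<sigma> * Z ^ length \<sigma>) summable_on compositions A"
proof (rule summable_onI_fps)
  fix n
  show "finite {\<sigma> \<in> compositions A. (X ^ sum_list \<sigma> * Y ^ r \<sigma> * Z ^ length \<sigma>) $ n \<noteq> 0}"
    by (rule finite_subset[OF _ finite_compositions[OF assms, of n]])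
       (auto simp: mult.assoc X_power_mult_nth split: if_splits)
qed

context
  fixes a :: "nat \<Rightarrow> nat" and d :: enat
  assumes pos: "\<forall>i\<in>idx d. 0 < a i" and mono: "strict_mono_on (idx d) a"
begin

lemma le_part: "j \<in> idx d \<Longrightarrow> j \<le> a j"
proof (induction j)
  case (Suc j)
  show ?case
  proof (cases "j = 0")
    case True
    then show ?thesis using Suc.prems pos by (auto simp: Suc_le_eq)
  next
    case False
    then have "j \<in> idx d"
      using Suc.prems by (auto simp: idx_def intro: order_trans[of "enat j" "enat (Suc j)"])
    then show ?thesis
      using Suc strict_mono_onD[OF mono, of j "Suc j"] by auto
  qed
qed simp

lemma summable_parts: "(\<lambda>j. X ^ a j * Z * f j) summable_on idx d"
proof (rule summable_onI_fps)
  fix n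
  have "{j \<in> idx d. (X ^ a j * Z * f j) $ n \<noteq> 0} \<subseteq> {..n}"
    using le_part by (fastforce simp: mult.assoc X_power_mult_nth split: if_splits)
  then show "finite {j \<in> idx d. (X ^ a j * Z * f j) $ n \<noteq> 0}"
    by (rule finite_subset) simp
qed

lemma denominator_nth_0: "(1 - (\<Sum>\<^sub>\<infinity>j\<in>idx d. X ^ a j * Z * f j)) $ 0 = 1"
proof -
  let ?g = "\<lambda>j. X ^ a j * Z * f j"
  have "(sum ?g \<longlongrightarrow> infsum ?g (idx d)) (finite_subsets_at_top (idx d))"
    using has_sum_infsum[OF summable_parts] by (simp add: has_sum_def)
  then have "\<forall>\<^sub>F F in finite_subsets_at_top (idx d). sum ?g F $ 0 = infsum ?g (idx d) $ 0"
    by (simp add: tendsto_fps_iff)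
  then obtain F where F: "F \<subseteq> idx d" "sum ?g F $ 0 = infsum ?g (idx d) $ 0"
    by (auto simp: eventually_finite_subsets_at_top)
  have "sum ?g F $ 0 = (\<Sum>j\<in>F. ?g j $ 0)" by (rule fps_sum_nth)
  also have "\<dots> = 0"
  proof (rule sum.neutral, rule ballI)
    fix j assume "j \<in> F"
    then have "0 < a j" using F(1) pos by auto
    then show "?g j $ 0 = 0" by (simp only: mult.assoc X_power_mult_nth if_True)
  qed
  finally show ?thesis using F(2) by simp
qed

lemma convergent_prod_parts:
  "(\<lambda>i. if j < i \<and> i \<in> idx d then 1 - (1 - Y) * X ^ (2 * a i) * Z ^ 2 else 1) has_prod
   (\<Prod>i. if j < i \<and> i \<in> idx d then 1 - (1 - Y) * X ^ (2 * a i) * Z ^ 2 else 1)"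
proof -
  let ?f = "\<lambda>i. if j < i \<and> i \<in> idx d then 1 - (1 - Y) * X ^ (2 * a i) * Z ^ 2 else (1 :: fps3)"
  have low: "?f i = 1 + X ^ i * (if j < i \<and> i \<in> idx d
                 then - (X ^ (2 * a i - i) * ((1 - Y) * Z ^ 2)) else 0)" for i
  proof (cases "j < i \<and> i \<in> idx d")
    case True
    then have "X ^ (2 * a i) = X ^ i * X ^ (2 * a i - i)"
      using le_part[of i] by (simp flip: power_add)
    with True show ?thesis by (simp only: if_True) (simp add: algebra_simps)
  qed (simp only: if_False, simp)
  have step: "(h * ?f i) $ n = h $ n" if "n < i" for h i n
  proof -
    have "h * ?f i = h + X ^ i * (h * (if j < i \<and> i \<in> idx d
             then - (X ^ (2 * a i - i) * ((1 - Y) * Z ^ 2)) else 0))"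
      by (subst low) (simp add: algebra_simps)
    then show ?thesis using that by (simp add: X_power_mult_nth)
  qed
  have stable: "(\<Prod>i\<le>m + n. ?f i) $ n = (\<Prod>i\<le>n. ?f i) $ n" for m n
  proof (induction m)
    case (Suc m)
    have "(\<Prod>i\<le>Suc m + n. ?f i) $ n = ((\<Prod>i\<le>m + n. ?f i) * ?f (Suc (m + n))) $ n"
      by (simp only: add_Suc prod.atMost_Suc)
    also have "\<dots> = (\<Prod>i\<le>m + n. ?f i) $ n" by (rule step) simp
    finally show ?case using Suc.IH by simp
  qed simp
  define p where "p = Abs_fps (\<lambda>n. (\<Prod>i\<le>n. ?f i) $ n)"
  have lim: "(\<lambda>n. \<Prod>i\<le>n. ?f i) \<longlonglongrightarrow> p"
  proof (rule tendsto_fpsI)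
    fix n
    show "\<forall>\<^sub>F m in sequentially. (\<Prod>i\<le>m. ?f i) $ n = p $ n"
      using eventually_ge_at_top[of n]
    proof eventually_elim
      case (elim m)
      then show ?case using stable[of "m - n" n] by (simp add: p_def)
    qed
  qed
  have "p $ 0 = 1" by (simp add: p_def idx_def)
  then have "p \<noteq> 0" by auto
  with lim have "raw_has_prod ?f 0 p"
    unfolding raw_has_prod_def add_0_right by (rule conjI)
  then have "?f has_prod p" unfolding has_prod_def by (rule disjI1)
  with has_prod_unique[OF this] show ?thesis by simp
qed

end

lemma quotient_correct:
  fixes D :: fps3
  assumes "D $ 0 = 1"
  shows "D * (1 / D) = 1"
proof -
  have "subdegree D = 0" using assms by (simp add: subdegree_eq_0_iff)
  then have "1 / D = inverse D" by (simp add: fps_divide_def)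
  moreover have "D * inverse D = 1"
  proof -
    have "inverse (1 :: rat fps) = 1" by (simp add: fps_inverse_one')
    then have "inverse (1 :: rat fps fps) = 1" by (simp add: fps_inverse_one')
    then show ?thesis
      unfolding fps_inverse_def by (intro fps_right_inverse) (simp add: assms)
  qed
  ultimately show ?thesis by simp
qed

end

theory Submission
  imports Defs
begin

text \<open>
  Put \<open>u a = x\<^sup>a z\<close> and let \<open>G K\<close> be the generating function of the nonempty compositions whose
  first part lies in \<open>K\<close>. A new occurrence of the pattern arises from prepending \<open>a\<close> to \<open>\<sigma>\<close> exactly
  if \<open>\<sigma>\<close> begins with \<open>a c\<close> where \<open>a < c\<close> (for \<open>112\<close>) or \<open>a > c\<close> (for \<open>221\<close>). As \<open>a \<noteq> c\<close>, prepending
  a single \<open>a\<close> to \<open>c \<tau>\<close> creates no occurrence, whence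
  \<open>G {a} = u a * C - (1 - y) * (u a)\<^sup>2 * G {c \<in> A. a < c}\<close>
  for \<open>112\<close>, and likewise for \<open>221\<close>. This is a first-order linear recurrence for the sums of \<open>G {a\<^sub>i}\<close>
  over \<open>i > n\<close>, respectively \<open>i \<le> n\<close>; solving it and letting \<open>n\<close> tend to infinity expresses
  \<open>C - 1 = G A\<close> as \<open>C\<close> times the sum in the denominator.
\<close>

section \<open>The topological ring of formal power series\<close>

text \<open>Near a series every fixed coefficient is locally constant, and addition acts
  coefficientwise. The rules for unordered sums rely on this continuity.\<close>

instance fps :: (group_add) topological_monoid_add
proof
  fix f g :: "'a fps"
  show "((\<lambda>p. fst p + snd p) \<longlongrightarrow> f + g) (nhds f \<times>\<^sub>F nhds g)"
  proof (rule tendsto_fpsI)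
    fix n
    have "\<forall>\<^sub>F h in nhds k. h $ n = k $ n" for k :: "'a fps"
      using filterlim_ident[of "nhds k"] unfolding tendsto_fps_iff by blast
    from eventually_prodI[OF this[of f] this[of g]]
    show "\<forall>\<^sub>F p in nhds f \<times>\<^sub>F nhds g. (fst p + snd p) $ n = (f + g) $ n"
      by eventually_elim simp
  qed
qed

instance fps :: (ab_group_add) topological_comm_monoid_add ..

text \<open>Coefficient \<open>n\<close> of a product depends only on the coefficients up to
  \<open>n\<close> of the factors, so finitely many agreements suffice.\<close>

instance fps :: (ring) topological_semigroup_mult
proof
  fix f g :: "'a fps"
  show "((\<lambda>p. fst p * snd p) \<longlongrightarrow> f * g) (nhds f \<times>\<^sub>F nhds g)"
  proof (rule tendsto_fpsI)
    fix n
    have "\<forall>\<^sub>F h in nhds k. \<forall>i\<in>{..n}. h $ i = k $ i" for k :: "'a fps"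
      using filterlim_ident[of "nhds k"] unfolding tendsto_fps_iff
      by (intro eventually_ball_finite) auto
    from eventually_prodI[OF this[of f] this[of g]]
    show "\<forall>\<^sub>F p in nhds f \<times>\<^sub>F nhds g. (fst p * snd p) $ n = (f * g) $ n"
      by eventually_elim (simp add: fps_mult_nth)
  qed
qed

text \<open>Recasts vanishing low coefficients as divisibility, so that error terms can be estimated
  by the rules for \<open>dvd\<close>.\<close>

lemma X_power_dvd_iff: "X ^ n dvd f \<longleftrightarrow> (\<forall>k<n. f $ k = 0)"
proof
  assume "\<forall>k<n. f $ k = 0"
  then have "f = X ^ n * fps_shift n f"
    by (intro fps_ext) (auto simp: X_power_mult_nth)
  then show "X ^ n dvd f" by (rule dvdI)
qed (auto simp: X_power_mult_nth elim!: dvdE)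

lemma X_power_dvd_limit:
  assumes "f \<longlonglongrightarrow> g" and "\<And>m. m \<ge> N \<Longrightarrow> X ^ n dvd f m"
  shows "X ^ n dvd g"
  unfolding X_power_dvd_iff
proof (intro allI impI)
  fix k assume "k < n"
  have "\<forall>\<^sub>F m in sequentially. f m $ k = g $ k"
    using assms(1) unfolding tendsto_fps_iff by blast
  moreover have "\<forall>\<^sub>F m in sequentially. f m $ k = 0"
    using eventually_ge_at_top[of N]
    by eventually_elim (use assms(2) \<open>k < n\<close> X_power_dvd_iff in blast)
  ultimately have "\<forall>\<^sub>F m in sequentially. g $ k = 0"
    by eventually_elim simp
  then show "g $ k = 0" by simp
qed

lemma tendsto_0_if_X_power_dvd:
  fixes f :: "nat \<Rightarrow> fps3"
  assumes "\<And>n. X ^ n dvd f n"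
  shows "f \<longlonglongrightarrow> 0"
proof (rule tendsto_fpsI)
  fix k
  show "\<forall>\<^sub>F n in sequentially. f n $ k = 0 $ k"
    using eventually_gt_at_top[of k]
    by eventually_elim (use assms X_power_dvd_iff in auto)
qed

lemma X_power_dvd_infsum:
  fixes f :: "'b \<Rightarrow> fps3"
  assumes "f summable_on S" and "\<And>s. s \<in> S \<Longrightarrow> X ^ n dvd f s"
  shows "X ^ n dvd infsum f S"
  unfolding X_power_dvd_iff
proof (intro allI impI)
  fix k assume "k < n"
  then have "f s $ k = 0" if "s \<in> S" for s
    using assms(2)[OF that] X_power_dvd_iff by blast
  then show "infsum f S $ k = 0"
    using has_sum_fpsD(2)[OF has_sum_infsum[OF assms(1)], of k] by simp
qed

text \<open>The constant coefficient 1 makes \<open>1 - S\<close> a unit, so the total division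
  yields a genuine quotient here.\<close>

lemma eq_divide_fps3:
  fixes C S :: fps3
  assumes "(1 - S) $ 0 = 1" and "C - 1 = C * S"
  shows "C = 1 / (1 - S)"
proof -
  have "C * (1 - S) = C - C * S" by (simp only: right_diff_distrib mult_1_right)
  also have "\<dots> = 1" unfolding assms(2)[symmetric] by simp
  finally have 1: "C * (1 - S) = 1" .
  have "C = C * ((1 - S) * (1 / (1 - S)))"
    by (simp only: quotient_correct[OF assms(1)] mult_1_right)
  also have "\<dots> = 1 / (1 - S)" by (simp only: mult.assoc[symmetric] 1 mult_1_left)
  finally show ?thesis .
qed

section \<open>Occurrences of a pattern\<close>

text \<open>Taking \<open>R\<close> as \<open>(<)\<close> gives 112 and as \<open>(>)\<close> gives
  221, so both patterns share one recurrence.\<close>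

definition occ :: "(nat \<Rightarrow> nat \<Rightarrow> bool) \<Rightarrow> nat list \<Rightarrow> nat" where
  "occ R \<sigma> = card {i. i + 2 < length \<sigma> \<and> \<sigma> ! i = \<sigma> ! (i + 1) \<and> R (\<sigma> ! (i + 1)) (\<sigma> ! (i + 2))}"

definition weight :: "(nat \<Rightarrow> nat \<Rightarrow> bool) \<Rightarrow> nat list \<Rightarrow> fps3" where
  "weight R \<sigma> = X ^ sum_list \<sigma> * Y ^ occ R \<sigma> * Z ^ length \<sigma>"

definition starting :: "nat set \<Rightarrow> nat set \<Rightarrow> nat list set" where
  "starting A K = {\<sigma> \<in> compositions A. \<sigma> \<noteq> [] \<and> hd \<sigma> \<in> K}"

lemma occ_Nil [simp]: "occ R [] = 0"
  by (simp add: occ_def)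

text \<open>Old occurrences move up by one position, so only position 0 can hold a new one.\<close>

lemma occ_Cons:
  "occ R (a # \<sigma>) = occ R \<sigma> + (if \<exists>c \<tau>. \<sigma> = a # c # \<tau> \<and> R a c then 1 else 0)"
proof -
  define P where
    "P \<sigma> i \<longleftrightarrow> i + 2 < length \<sigma> \<and> \<sigma> ! i = \<sigma> ! (i + 1) \<and> R (\<sigma> ! (i + 1)) (\<sigma> ! (i + 2))" for \<sigma> i
  have occ: "occ R \<sigma> = card {i. P \<sigma> i}" for \<sigma>
    by (simp add: occ_def P_def)
  have fin: "finite {i. P \<sigma> i}"
    by (rule finite_subset[of _ "{..<length \<sigma>}"]) (auto simp: P_def)
  have Suc: "P (a # \<sigma>) (Suc i) \<longleftrightarrow> P \<sigma> i" for i
    by (simp add: P_def)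
  have 0: "P (a # \<sigma>) 0 \<longleftrightarrow> (\<exists>c \<tau>. \<sigma> = a # c # \<tau> \<and> R a c)"
    by (cases \<sigma>; cases "tl \<sigma>") (auto simp: P_def)
  have "{i. P (a # \<sigma>) i} = Suc ` {i. P \<sigma> i} \<union> (if P (a # \<sigma>) 0 then {0} else {})"
    (is "?L = ?R")
  proof (rule set_eqI)
    fix i show "i \<in> ?L \<longleftrightarrow> i \<in> ?R" by (cases i) (auto simp: Suc)
  qed
  then have "card {i. P (a # \<sigma>) i} = card (Suc ` {i. P \<sigma> i}) + (if P (a # \<sigma>) 0 then 1 else 0)"
    using fin by (auto simp: card_insert_if)
  then show ?thesis
    unfolding occ 0[symmetric] by (simp add: card_image)
qed

lemma weight_Nil [simp]: "weight R [] = 1"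
  by (simp add: weight_def)

text \<open>Writing an extra factor \<open>Y\<close> as \<open>1 + (Y - 1)\<close> turns a new
  occurrence into an additive correction that can be summed separately.\<close>

lemma weight_Cons:
  "weight R (a # \<sigma>) =
     X ^ a * Z * (weight R \<sigma> + (Y - 1) * (if \<exists>c \<tau>. \<sigma> = a # c # \<tau> \<and> R a c then weight R \<sigma> else 0))"
  unfolding weight_def occ_Cons
  by (cases "\<exists>c \<tau>. \<sigma> = a # c # \<tau> \<and> R a c"; simp only: if_True if_False)
     (simp_all add: power_add algebra_simps)

lemma X_power_dvd_weight: "n \<le> sum_list \<sigma> \<Longrightarrow> X ^ n dvd weight R \<sigma>"
  unfolding weight_def by (intro dvd_mult2 le_imp_power_dvd)

lemma compositions_eq: "compositions A = insert [] (starting A A)"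
  by (auto simp: compositions_def starting_def)

lemma starting_Un: "starting A (K \<union> L) = starting A K \<union> starting A L"
  by (auto simp: starting_def)

section \<open>Generating functions of compositions classified by their first part\<close>

locale pattern =
  fixes R :: "nat \<Rightarrow> nat \<Rightarrow> bool" and A :: "nat set"
  assumes irrefl: "\<not> R a a" and no_0: "0 \<notin> A"
begin

definition G :: "nat set \<Rightarrow> fps3" where
  "G K = infsum (weight R) (starting A K)"

definition C :: fps3 where
  "C = infsum (weight R) (compositions A)"

lemma summable_weight: "B \<subseteq> compositions A \<Longrightarrow> weight R summable_on B"
proof (rule summable_onI_fps)
  fix n
  assume "B \<subseteq> compositions A"
  then show "finite {\<sigma> \<in> B. weight R \<sigma> $ n \<noteq> 0}"
    by (intro finite_subset[OF _ finite_compositions[OF no_0, of n]])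
       (auto simp: weight_def mult.assoc X_power_mult_nth split: if_splits)
qed

lemma starting_subset: "starting A K \<subseteq> compositions A"
  by (auto simp: starting_def)

lemma G_has_sum: "(weight R has_sum G K) (starting A K)"
  unfolding G_def by (intro has_sum_infsum summable_weight starting_subset)

lemma C_has_sum: "(weight R has_sum C) (compositions A)"
  unfolding C_def by (intro has_sum_infsum summable_weight order_refl)

lemma G_empty [simp]: "G {} = 0"
  by (simp add: G_def starting_def)

lemma G_Un: "K \<inter> L = {} \<Longrightarrow> G (K \<union> L) = G K + G L"
  unfolding G_def starting_Un
  by (intro infsum_Un_disjoint summable_weight starting_subset) (auto simp: starting_def)

lemma C_eq: "C = 1 + G A"
  unfolding C_def compositions_eq G_def
  by (subst infsum_insert)
     (auto intro!: summable_weight starting_subset simp: starting_def)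

text \<open>The first part of a composition is a lower bound for its sum.\<close>

lemma X_power_dvd_G:
  assumes "\<And>a. a \<in> K \<Longrightarrow> n \<le> a"
  shows "X ^ n dvd G K"
  unfolding G_def
proof (rule X_power_dvd_infsum)
  fix \<sigma> assume "\<sigma> \<in> starting A K"
  then have "n \<le> hd \<sigma>" "hd \<sigma> \<le> sum_list \<sigma>"
    using assms by (auto simp: starting_def intro: member_le_sum_list)
  then show "X ^ n dvd weight R \<sigma>" by (intro X_power_dvd_weight) simp
qed (intro summable_weight starting_subset)

text \<open>\<open>weight_Cons\<close> is summed over all compositions. Its correction lives on
  those satisfying \<open>P\<close>, which arise by prepending \<open>a\<close> to the members of
  \<open>?H\<close>.\<close>

lemma G_single:
  assumes "a \<in> A"
  shows "G {a} = X ^ a * Z * C - (1 - Y) * (X ^ a * Z)\<^sup>2 * G {c \<in> A. R a c}"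
proof -
  let ?u = "X ^ a * Z" and ?H = "starting A {c \<in> A. R a c}"
  define P where "P \<sigma> \<longleftrightarrow> (\<exists>c \<tau>. \<sigma> = a # c # \<tau> \<and> R a c)" for \<sigma>
  have weight: "weight R (a # \<sigma>) = ?u * (weight R \<sigma> + (Y - 1) * (if P \<sigma> then weight R \<sigma> else 0))" for \<sigma>
    unfolding P_def by (rule weight_Cons)
  \<comment> \<open>A list in \<open>?H\<close> starts with some \<open>c\<close> such that
    \<open>R a c\<close>; under \<open>P\<close> it would also start with \<open>a\<close>, against
    \<open>irrefl\<close>.\<close>
  have "\<not> P \<sigma>" if "\<sigma> \<in> ?H" for \<sigma>
    using that irrefl by (auto simp: starting_def P_def)
  then have weight_H: "weight R (a # \<sigma>) = ?u * weight R \<sigma>" if "\<sigma> \<in> ?H" for \<sigma>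
    unfolding weight using that by simp
  have "((\<lambda>\<sigma>. ?u * weight R \<sigma>) has_sum ?u * G {c \<in> A. R a c}) ?H"
    by (intro has_sum_cmult_right G_has_sum)
  then have "((weight R \<circ> (#) a) has_sum ?u * G {c \<in> A. R a c}) ?H"
    by (rule has_sum_cong[THEN iffD2, rotated]) (simp add: weight_H)
  then have "(weight R has_sum ?u * G {c \<in> A. R a c}) ((#) a ` ?H)"
    by (subst has_sum_reindex) auto
  moreover have "(#) a ` ?H = {\<sigma> \<in> compositions A. P \<sigma>}" (is "?L = ?R")
  proof (intro equalityI subsetI)
    fix \<sigma> assume "\<sigma> \<in> ?R"
    then obtain c \<tau> where "\<sigma> = a # c # \<tau>" "c # \<tau> \<in> ?H"
      by (auto simp: P_def starting_def compositions_def)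
    then show "\<sigma> \<in> ?L" by blast
  qed (use assms in \<open>auto simp: P_def starting_def compositions_def neq_Nil_conv\<close>)
  ultimately have "(weight R has_sum ?u * G {c \<in> A. R a c}) {\<sigma> \<in> compositions A. P \<sigma>}"
    by simp
  then have "((\<lambda>\<sigma>. if P \<sigma> then weight R \<sigma> else 0) has_sum ?u * G {c \<in> A. R a c}) (compositions A)"
    by (rule has_sum_cong_neutral[THEN iffD1, rotated -1]) auto
  then have "((weight R \<circ> (#) a) has_sum ?u * (C + (Y - 1) * (?u * G {c \<in> A. R a c})))
      (compositions A)"
    unfolding comp_def weight
    by (intro has_sum_cmult_right has_sum_add C_has_sum)
  then have "(weight R has_sum ?u * (C + (Y - 1) * (?u * G {c \<in> A. R a c})))
      ((#) a ` compositions A)"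
    by (subst has_sum_reindex) auto
  moreover have "(#) a ` compositions A = starting A {a}"
    using assms by (auto simp: starting_def compositions_def image_iff neq_Nil_conv)
  ultimately have "G {a} = ?u * (C + (Y - 1) * (?u * G {c \<in> A. R a c}))"
    using has_sum_unique[OF G_has_sum, of "{a}"] by simp
  then show ?thesis by (simp add: power2_eq_square algebra_simps)
qed

end

section \<open>Solving the recurrences\<close>

locale parts =
  fixes a :: "nat \<Rightarrow> nat" and d :: enat
  assumes pos: "\<forall>i\<in>idx d. 0 < a i" and mono: "strict_mono_on (idx d) a"
begin

text \<open>The value 0 off \<open>idx d\<close> lets sums run over all naturals, uniformly for
  finite and infinite \<open>d\<close>.\<close>

definition u :: "nat \<Rightarrow> fps3" where
  "u i = (if i \<in> idx d then X ^ a i * Z else 0)"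

text \<open>The multiplier of the recurrence: 1 comes from the sum carried along, the rest from the
  correction in \<open>G_single\<close>.\<close>

definition q :: "nat \<Rightarrow> fps3" where
  "q i = 1 - (1 - Y) * (u i)\<^sup>2"

lemma not_0_in_image: "0 \<notin> a ` idx d"
  using pos by force

lemma zero_notin_idx [simp]: "0 \<notin> idx d"
  by (simp add: idx_def)

lemma u_0 [simp]: "u 0 = 0"
  by (simp add: u_def)

lemma le_a: "i \<in> idx d \<Longrightarrow> i \<le> a i"
  using le_part[OF pos mono] .

lemma a_less_iff: "i \<in> idx d \<Longrightarrow> j \<in> idx d \<Longrightarrow> a i < a j \<longleftrightarrow> i < j"
  using strict_mono_on_less[OF mono] by blast

lemma X_power_dvd_u: "X ^ i dvd u i"
  by (auto simp: u_def intro!: dvd_mult2 le_imp_power_dvd le_a)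

lemma q_eq: "q i = (if i \<in> idx d then 1 - (1 - Y) * X ^ (2 * a i) * Z ^ 2 else 1)"
  by (simp add: q_def u_def power_mult_distrib power_mult mult.assoc)
     (simp add: power_mult[symmetric] mult.commute)

lemma has_sum_u:
  "((\<lambda>j. u j * f j) has_sum (\<Sum>\<^sub>\<infinity>j\<in>idx d. X ^ a j * Z * f j)) UNIV"
proof -
  have "((\<lambda>j. X ^ a j * Z * f j) has_sum (\<Sum>\<^sub>\<infinity>j\<in>idx d. X ^ a j * Z * f j)) (idx d)"
    by (intro has_sum_infsum summable_parts[OF pos mono])
  then show ?thesis
    by (subst has_sum_cong_neutral[where g = "\<lambda>j. X ^ a j * Z * f j" and T = "idx d"])
       (auto simp: u_def)
qed

lemma tendsto_sum_u:
  "(\<lambda>n. \<Sum>j\<le>n. u j * f j) \<longlonglongrightarrow> (\<Sum>\<^sub>\<infinity>j\<in>idx d. X ^ a j * Z * f j)"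
  using has_sum_imp_sums[OF has_sum_u] by (simp add: sums_def_le)

end

locale pattern_parts = parts a d + pattern R "a ` idx d"
  for a :: "nat \<Rightarrow> nat" and d :: enat and R :: "nat \<Rightarrow> nat \<Rightarrow> bool"
begin

abbreviation G\<^sub>i :: "nat set \<Rightarrow> fps3" where
  "G\<^sub>i I \<equiv> G (a ` (idx d \<inter> I))"

lemma G\<^sub>i_Un: "I \<inter> J = {} \<Longrightarrow> G\<^sub>i (I \<union> J) = G\<^sub>i I + G\<^sub>i J"
  unfolding Int_Un_distrib image_Un
  using strict_mono_on_imp_inj_on[OF mono]
  by (intro G_Un) (auto dest: inj_onD)

lemma C_eq_G\<^sub>i: "C = 1 + G\<^sub>i {..n} + G\<^sub>i {n<..}"
proof -
  have "{..n} \<union> {n<..} = UNIV" "{..n} \<inter> {n<..} = {}" by auto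
  then have "G (a ` idx d) = G\<^sub>i {..n} + G\<^sub>i {n<..}"
    using G\<^sub>i_Un[of "{..n}" "{n<..}"] by (simp only: Int_UNIV_right)
  then show ?thesis by (simp only: C_eq add.assoc)
qed

lemma G\<^sub>i_single: "G\<^sub>i {j} = u j * C - (1 - Y) * (u j)\<^sup>2 * G\<^sub>i {i. R (a j) (a i)}"
proof (cases "j \<in> idx d")
  case True
  moreover have "{c \<in> a ` idx d. R (a j) c} = a ` (idx d \<inter> {i. R (a j) (a i)})"
    by auto
  ultimately show ?thesis using G_single[of "a j"] by (simp add: u_def)
qed (simp add: u_def)

text \<open>Since \<open>i \<le> a i\<close>, every part with index above \<open>n\<close> exceeds
  \<open>n\<close>. This makes the remainder vanish in the limit.\<close>

lemma X_power_dvd_tail: "X ^ n dvd G\<^sub>i {n<..}"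
  by (intro X_power_dvd_G) (auto dest: le_a)

lemma tail_tendsto: "(\<lambda>n. f n * G\<^sub>i {n<..}) \<longlonglongrightarrow> 0"
  by (intro tendsto_0_if_X_power_dvd dvd_mult X_power_dvd_tail)

end

section \<open>The pattern 112: descending through the tails\<close>

locale pattern_112 = pattern_parts a d "(<)" for a d
begin

lemma G\<^sub>i_single_112: "G\<^sub>i {j} = u j * C - (1 - Y) * (u j)\<^sup>2 * G\<^sub>i {j<..}"
proof (cases "j \<in> idx d")
  case True
  then have "idx d \<inter> {i. a j < a i} = idx d \<inter> {j<..}" by (auto simp: a_less_iff)
  then show ?thesis using G\<^sub>i_single[of j] by simp
qed (simp add: u_def)

text \<open>Unrolls the recurrence \<open>n\<close> times; each step splits off the index
  \<open>Suc n\<close> and multiplies the remaining tail by \<open>q (Suc n)\<close>.\<close>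

lemma partial_112: "C - 1 = C * (\<Sum>j\<le>n. u j * (\<Prod>i=1..j-1. q i)) + (\<Prod>i=1..n. q i) * G\<^sub>i {n<..}"
proof (induction n)
  case 0
  have "idx d \<inter> {..0} = {}" by auto
  then show ?case using C_eq_G\<^sub>i[of 0] by simp
next
  case (Suc n)
  have "{n<..} = {Suc n} \<union> {Suc n<..}" by auto
  then have "G\<^sub>i {n<..} = G\<^sub>i {Suc n} + G\<^sub>i {Suc n<..}"
    using G\<^sub>i_Un[of "{Suc n}" "{Suc n<..}"] by simp
  also have "\<dots> = u (Suc n) * C + q (Suc n) * G\<^sub>i {Suc n<..}"
    by (subst G\<^sub>i_single_112) (simp add: q_def algebra_simps)
  finally show ?case using Suc.IH by (simp add: algebra_simps)
qed

lemma C_minus_1_112: "C - 1 = C * (\<Sum>\<^sub>\<infinity>j\<in>idx d. X ^ a j * Z * (\<Prod>i=1..j-1. q i))"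
proof -
  have "(\<lambda>n. C * (\<Sum>j\<le>n. u j * (\<Prod>i=1..j-1. q i)) + (\<Prod>i=1..n. q i) * G\<^sub>i {n<..})
      \<longlonglongrightarrow> C * (\<Sum>\<^sub>\<infinity>j\<in>idx d. X ^ a j * Z * (\<Prod>i=1..j-1. q i)) + 0"
    by (intro tendsto_add tendsto_mult tendsto_const tendsto_sum_u tail_tendsto)
  \<comment> \<open>By \<open>partial_112\<close> the sequence is constantly \<open>C - 1\<close>,
    so this is its limit.\<close>
  then show ?thesis
    unfolding partial_112[symmetric] by (simp add: LIMSEQ_const_iff)
qed

end

section \<open>The pattern 221: ascending through the initial segments\<close>

locale pattern_221 = pattern_parts a d "(>)" for a d
begin

lemma G\<^sub>i_single_221: "G\<^sub>i {j} = u j * C - (1 - Y) * (u j)\<^sup>2 * G\<^sub>i {..<j}"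
proof (cases "j \<in> idx d")
  case True
  then have "idx d \<inter> {i. a j > a i} = idx d \<inter> {..<j}" by (auto simp: a_less_iff)
  then show ?thesis using G\<^sub>i_single[of j] by simp
qed (simp add: u_def)

text \<open>The recurrence starts from an empty index set, so no remainder appears; in exchange the
  products depend on the upper bound \<open>n\<close>.\<close>

lemma partial_221: "G\<^sub>i {..n} = C * (\<Sum>j\<le>n. u j * (\<Prod>i\<in>{j<..n}. q i))"
proof (induction n)
  case 0
  have "idx d \<inter> {..0} = {}" by auto
  then show ?case by simp
next
  case (Suc n)
  have "{..Suc n} = {..n} \<union> {Suc n}" by auto
  then have "G\<^sub>i {..Suc n} = G\<^sub>i {..n} + G\<^sub>i {Suc n}"
    using G\<^sub>i_Un[of "{..n}" "{Suc n}"] by simp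
  also have "\<dots> = u (Suc n) * C + q (Suc n) * G\<^sub>i {..n}"
    by (subst G\<^sub>i_single_221) (simp add: q_def algebra_simps lessThan_Suc_atMost)
  also have "q (Suc n) * G\<^sub>i {..n} = C * (\<Sum>j\<le>n. u j * (\<Prod>i\<in>{j<..Suc n}. q i))"
  proof -
    \<comment> \<open>The remaining summand \<open>j = Suc n\<close> has an empty product and is the
      term \<open>u (Suc n) * C\<close>.\<close>
    have "{j<..Suc n} = insert (Suc n) {j<..n}" if "j \<le> n" for j using that by auto
    then show ?thesis
      unfolding Suc.IH by (simp add: sum_distrib_left algebra_simps)
  qed
  finally show ?case by (simp add: algebra_simps)
qed

text \<open>Both the summation bound and the products in \<open>partial_221\<close> move with
  \<open>n\<close>. Replacing each truncated product \<open>p j n\<close> by its limit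
  \<open>Q j\<close> costs an error divisible by \<open>X ^ n\<close>, which vanishes in the
  limit.\<close>

lemma C_minus_1_221:
  "C - 1 = C * (\<Sum>\<^sub>\<infinity>j\<in>idx d. X ^ a j * Z * (\<Prod>i. if j < i \<and> i \<in> idx d
       then 1 - (1 - Y) * X ^ (2 * a i) * Z ^ 2 else 1))"
proof -
  define Q where
    "Q j = (\<Prod>i. if j < i \<and> i \<in> idx d then 1 - (1 - Y) * X ^ (2 * a i) * Z ^ 2 else (1::fps3))" for j
  define p where "p j n = (\<Prod>i\<in>{j<..n}. q i)" for j n
  have lim_p: "p j \<longlonglongrightarrow> Q j" for j
  proof -
    have "(\<Prod>i\<le>n. if j < i \<and> i \<in> idx d then 1 - (1 - Y) * X ^ (2 * a i) * Z ^ 2 else 1) = p j n" for n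
    proof -
      have "p j n = (\<Prod>i\<in>{i\<in>{..n}. j < i}. q i)"
        unfolding p_def by (intro prod.cong) auto
      also have "\<dots> = (\<Prod>i\<le>n. if j < i then q i else 1)"
        by (intro prod.inter_filter) simp
      finally show ?thesis by (auto simp: q_eq intro!: prod.cong)
    qed
    then show ?thesis
      using has_prod_imp_tendsto[OF convergent_prod_parts[OF pos mono, of j]]
      unfolding Q_def by (simp only:)
  qed
  \<comment> \<open>Every factor \<open>q i\<close> with \<open>i > n\<close> is 1 modulo
    \<open>X ^ n\<close>.\<close>
  have dvd_p: "X ^ n dvd p j m - p j n" if "n \<le> m" "j \<le> n" for j m n
    using that(1)
  proof (induction m rule: dec_induct)
    case (step m)
    have "{j<..Suc m} = insert (Suc m) {j<..m}" using step that by auto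
    then have "p j (Suc m) = q (Suc m) * p j m" by (simp add: p_def)
    then have diff: "p j (Suc m) - p j n = (p j m - p j n) - (1 - Y) * (u (Suc m))\<^sup>2 * p j m"
      by (simp add: q_def algebra_simps)
    have "X ^ n dvd X ^ Suc m" using step by (intro le_imp_power_dvd) simp
    then have "X ^ n dvd u (Suc m)" by (rule dvd_trans[OF _ X_power_dvd_u])
    from dvd_mult2[OF dvd_mult[OF dvd_mult[OF this]]]
    have "X ^ n dvd (1 - Y) * (u (Suc m))\<^sup>2 * p j m"
      unfolding power2_eq_square .
    with step.IH show ?case unfolding diff by (rule dvd_diff)
  qed simp
  have "X ^ n dvd Q j - p j n" if "j \<le> n" for j n
  proof (rule X_power_dvd_limit)
    show "(\<lambda>m. p j m - p j n) \<longlonglongrightarrow> Q j - p j n"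
      using tendsto_add[OF lim_p[of j] tendsto_const[of "- p j n"]]
      by (simp only: add_uminus_conv_diff)
  qed (rule dvd_p[OF _ that])
  then have "X ^ n dvd (\<Sum>j\<le>n. u j * (Q j - p j n))" for n
    by (intro dvd_sum dvd_mult) simp
  then have "(\<lambda>n. \<Sum>j\<le>n. u j * (Q j - p j n)) \<longlonglongrightarrow> 0"
    by (rule tendsto_0_if_X_power_dvd)
  \<comment> \<open>The factors \<open>(- 1)\<close> and \<open>1\<close> give the expression the
    shape expected by the limit rules for products and by \<open>tail_tendsto\<close>.\<close>
  then have "(\<lambda>n. C * ((\<Sum>j\<le>n. u j * Q j) + (- 1) * (\<Sum>j\<le>n. u j * (Q j - p j n))) + 1 * G\<^sub>i {n<..})
      \<longlonglongrightarrow> C * ((\<Sum>\<^sub>\<infinity>j\<in>idx d. X ^ a j * Z * Q j) + (- 1) * 0) + 0"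
    by (intro tendsto_add tendsto_mult tendsto_const tendsto_sum_u tail_tendsto)
  moreover have "C * ((\<Sum>j\<le>n. u j * Q j) + (- 1) * (\<Sum>j\<le>n. u j * (Q j - p j n))) + 1 * G\<^sub>i {n<..} = C - 1" for n
  proof -
    have "(\<Sum>j\<le>n. u j * Q j) + (- 1) * (\<Sum>j\<le>n. u j * (Q j - p j n)) = (\<Sum>j\<le>n. u j * p j n)"
      by (simp add: sum_subtractf right_diff_distrib)
    moreover have "C - 1 = G\<^sub>i {..n} + G\<^sub>i {n<..}"
      by (subst C_eq_G\<^sub>i[of n]) simp
    ultimately show ?thesis by (simp only: partial_221 p_def mult_1_left)
  qed
  ultimately show ?thesis
    unfolding Q_def[symmetric] by (simp add: LIMSEQ_const_iff)
qed

end

theorem theorem2: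
  fixes a :: "nat \<Rightarrow> nat" and d :: enat and A :: "nat set"
  assumes pos: "\<forall>i\<in>idx d. 0 < a i"
    and mono: "strict_mono_on (idx d) a"
    and A: "A = a ` idx d"
  shows "C112 A =
      1 / (1 - (\<Sum>\<^sub>\<infinity>j\<in>idx d. X ^ a j * Z *
                 (\<Prod>i=1..j-1. 1 - (1 - Y) * X ^ (2 * a i) * Z ^ 2)))
    \<and> C221 A =
      1 / (1 - (\<Sum>\<^sub>\<infinity>j\<in>idx d. X ^ a j * Z *
                 (\<Prod>i. if j < i \<and> i \<in> idx d
                       then 1 - (1 - Y) * X ^ (2 * a i) * Z ^ 2 else 1)))"
proof
  interpret parts a d using pos mono by unfold_locales
  interpret p112: pattern_112 a d
    by unfold_locales (use not_0_in_image in auto)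
  interpret p221: pattern_221 a d
    by unfold_locales (use not_0_in_image in auto)
  have "C112 A = p112.C"
    by (simp add: C112_def p112.C_def weight_def[abs_def] occ_def occ112_def A)
  moreover have "(\<Prod>i=1..j-1. q i) = (\<Prod>i=1..j-1. 1 - (1 - Y) * X ^ (2 * a i) * Z ^ 2)"
    if "j \<in> idx d" for j
  proof (intro prod.cong refl)
    fix i assume "i \<in> {1..j-1}"
    then have "1 \<le> i" "enat i \<le> enat j" by auto
    \<comment> \<open>\<open>idx d\<close> is closed downwards among positive indices, so
      \<open>q i\<close> does not take its default value 1.\<close>
    then have "i \<in> idx d" using that order_trans unfolding idx_def by blast
    then show "q i = 1 - (1 - Y) * X ^ (2 * a i) * Z ^ 2" by (simp add: q_eq)
  qed
  then have "(\<Sum>\<^sub>\<infinity>j\<in>idx d. X ^ a j * Z * (\<Prod>i=1..j-1. q i)) = (\<Sum>\<^sub>\<infinity>j\<in>idx d. X ^ a j * Z *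
                 (\<Prod>i=1..j-1. 1 - (1 - Y) * X ^ (2 * a i) * Z ^ 2))"
    by (intro infsum_cong) simp
  ultimately show "C112 A =
      1 / (1 - (\<Sum>\<^sub>\<infinity>j\<in>idx d. X ^ a j * Z *
                 (\<Prod>i=1..j-1. 1 - (1 - Y) * X ^ (2 * a i) * Z ^ 2)))"
    using p112.C_minus_1_112
    by (intro eq_divide_fps3 denominator_nth_0[OF pos mono]) (simp only:)
  have "C221 A = p221.C"
    by (simp add: C221_def p221.C_def weight_def[abs_def] occ_def occ221_def A)
  then show "C221 A =
      1 / (1 - (\<Sum>\<^sub>\<infinity>j\<in>idx d. X ^ a j * Z *
                 (\<Prod>i. if j < i \<and> i \<in> idx d
                       then 1 - (1 - Y) * X ^ (2 * a i) * Z ^ 2 else 1)))"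
    using p221.C_minus_1_221
    by (intro eq_divide_fps3 denominator_nth_0[OF pos mono]) (simp only:)
qed

end
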